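(* Let $D\ge 2$ be squarefree, $K=\mathbb{Q}(\sqrt D)$, and let $\omega_D = [\lceil u_0/2\rceil; \overline{u_1,\dots,u_s}]$ be the continued fraction expansion of $\omega_D$ (with $u_s=u_0$). If $B := \max\{u_i \,:\, i \geq 1 \text{ odd}\}$, then \[ S := \left\{1,2,\dots,\left\lfloor \tfrac{B}{2}\right\rfloor + 2\right\} \subset p_K(\mathcal{O}_K^+), \] i.e. for every $m \in S$ there exists $\alpha \in \mathcal{O}_K^+$ with exactly $m$ partitions.
   Context: $\omega_D=\sqrt D$ if $D\equiv 2,3\pmod 4$ and $\omega_D=(1+\sqrt D)/2$ if $D\equiv1\pmod 4$. Its continued fraction is eventually periodic of the form $[\lceil u_0/2\rceil;\overline{u_1,\dots,u_s}]$ with $u_s=u_0$, and the $u_i$ are extended periodically to all $i\ge 1$. $\mathcal{O}_K^+$ is the set of totally positive algebraic integers of $K$ (both real embeddings positive). A partition of $\alpha\in\mathcal{O}_K^+$ is a representation $\alpha=\lambda_1+\dots+\lambda_\ell$ with $\ell\ge1$ and all $\lambda_i\in\mathcal{O}_K^+$, unordered (representations differing only by order of summands are the same); $p_K(\alpha)$ is the number of partitions of $\alpha$, and $p_K(\mathcal{O}_K^+)$ is the set of values $p_K(\alpha)$, $\alpha\in\mathcal{O}_K^+$. *)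

theory Defs
  imports Complex_Main "HOL-Library.Multiset"
    "HOL-Computational_Algebra.Computational_Algebra"
begin

definition omega :: "nat \<Rightarrow> real" where
  "omega D = (if D mod 4 = 1 then (1 + sqrt (real D)) / 2 else sqrt (real D))"

text \<open>
  The continued fraction algorithm.  For irrational \<open>x\<close>, no complete quotient is an integer, so the
  division below is proper, and \<open>x = [cf_coeff x 0; cf_coeff x 1, cf_coeff x 2, \<dots>]\<close>.
\<close>

primrec complete_quotient :: "real \<Rightarrow> nat \<Rightarrow> real" where
  "complete_quotient x 0 = x"
| "complete_quotient x (Suc n) = 1 / frac (complete_quotient x n)"

definition cf_coeff :: "real \<Rightarrow> nat \<Rightarrow> int" where
  "cf_coeff x n = \<lfloor>complete_quotient x n\<rfloor>"

definition quadratic_field :: "nat \<Rightarrow> real set" where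
  "quadratic_field D = {of_rat a + of_rat b * sqrt (real D) | a b. True}"

text \<open>
  For \<open>D\<close> not a perfect square, the representation \<open>x = a + b \<surd>D\<close> is unique, and the two real
  embeddings of the field map \<open>x\<close> to \<open>a + b \<surd>D\<close> and to \<open>a - b \<surd>D\<close>.
\<close>

definition totally_positive :: "nat \<Rightarrow> real \<Rightarrow> bool" where
  "totally_positive D x \<longleftrightarrow>
    (\<exists>a b. x = of_rat a + of_rat b * sqrt (real D)
      \<and> of_rat a + of_rat b * sqrt (real D) > 0
      \<and> of_rat a - of_rat b * sqrt (real D) > 0)"

definition totally_positive_integers :: "nat \<Rightarrow> real set" where
  "totally_positive_integers D =
    {x \<in> quadratic_field D. algebraic_int x \<and> totally_positive D x}"

definition partitions :: "nat \<Rightarrow> real \<Rightarrow> real multiset set" where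
  "partitions D \<alpha> =
    {M. M \<noteq> {#} \<and> set_mset M \<subseteq> totally_positive_integers D \<and> sum_mset M = \<alpha>}"

text \<open>
  The set of partitions is finite for every totally positive integer; an infinite set would give the
  value 0, so a positive value of \<open>num_partitions\<close> always is a genuine count.
\<close>

definition num_partitions :: "nat \<Rightarrow> real \<Rightarrow> nat" where
  "num_partitions D \<alpha> = card (partitions D \<alpha>)"

end

theory Submission
  imports Defs
begin

text \<open>
  Write the convergents of \<open>\<omega>\<close> as \<open>p\<^sub>i / q\<^sub>i\<close> and put \<open>\<alpha>\<^sub>i = p\<^sub>i - q\<^sub>i \<omega>\<close> (the conjugates of the
  elements usually denoted so).  Two consecutive ones, \<open>E = \<alpha>\<^sub>i\<close> and \<open>F = \<alpha>\<^sub>i\<^sub>+\<^sub>1\<close>, form a basis of the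
  ring of integers; for odd \<open>i\<close>, \<open>E\<close> is totally positive while \<open>F\<close> is negative with positive
  conjugate, so every totally positive integer \<open>x E + y F\<close> has \<open>x \<ge> 1\<close>.  Hence \<open>E\<close> is
  indecomposable, and for \<open>0 \<le> k \<le> u\<^sub>i\<^sub>+\<^sub>2\<close> a partition of \<open>2 E + k F\<close> has at most two parts, those with
  two parts being \<open>(E + a F) + (E + (k - a) F)\<close> with \<open>0 \<le> a \<le> k\<close>.  This gives \<open>\<lfloor>k / 2\<rfloor> + 2\<close> partitions.
\<close>

section \<open>Integers of a quadratic field\<close>

lemma map_poly_of_int_add:
  "map_poly of_int (p + q) = map_poly of_int p + map_poly (of_int :: int \<Rightarrow> 'a::ring_1) q"
  by (intro poly_eqI) (simp add: coeff_map_poly)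

lemma map_poly_of_int_mult:
  "map_poly of_int (p * q) = map_poly of_int p * map_poly (of_int :: int \<Rightarrow> 'a::comm_ring_1) q"
  by (intro poly_eqI) (simp add: coeff_map_poly coeff_mult)

lemma of_int_linear_eq_0_iff:
  fixes x :: real and b c :: int
  assumes "x \<notin> \<rat>"
  shows "of_int c + of_int b * x = 0 \<longleftrightarrow> b = 0 \<and> c = 0"
proof -
  have "b = 0" if "of_int c + of_int b * x = 0"
  proof (rule ccontr)
    assume "b \<noteq> 0"
    with that have "x = of_int (- c) / of_int b"
      by (simp add: field_simps)
    with assms show False
      by (metis Rats_divide Rats_of_int)
  qed
  then show ?thesis
    by auto
qed

text \<open>Pseudo-dividing a monic integer polynomial with root \<open>x\<close> by the quadratic
  leaves a remainder of degree at most 1, which is zero because \<open>x\<close> is irrational. By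
  Gauss's lemma the quadratic then divides the monic polynomial over the integers.\<close>

lemma algebraic_int_primitive_quadratic_lead_unit:
  fixes x :: real and a b c :: int
  assumes alg: "algebraic_int x" and irr: "x \<notin> \<rat>"
    and root: "of_int a * x\<^sup>2 + of_int b * x + of_int c = 0"
    and prim: "content [:c, b, a:] = 1"
  shows "a dvd 1"
proof -
  obtain p :: "int poly" where p: "poly (map_poly of_int p) x = 0" "lead_coeff p = 1"
    using alg by (auto simp: algebraic_int_altdef_ipoly)
  have "a \<noteq> 0"
  proof
    assume "a = 0"
    with root have "of_int c + of_int b * x = 0" by simp
    then have "b = 0 \<and> c = 0" using irr of_int_linear_eq_0_iff by blast
    with \<open>a = 0\<close> prim show False by simp
  qed
  define q where "q = [:c, b, a:]"
  have q: "degree q = 2" "lead_coeff q = a" "q \<noteq> 0"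
    using \<open>a \<noteq> 0\<close> by (auto simp: q_def)
  obtain h r where hr: "pseudo_divmod p q = (h, r)"
    by fastforce
  define e where "e = a ^ (Suc (degree p) - degree q)"
  have eq: "smult e p = q * h + r" and r: "r = 0 \<or> degree r < degree q"
    using pseudo_divmod[OF q(3) hr] q(2) by (auto simp: e_def)
  have qx: "poly (map_poly of_int q) x = 0"
    using root by (simp add: q_def map_poly_pCons algebra_simps power2_eq_square)
  have "map_poly real_of_int (smult e p) = smult (of_int e) (map_poly of_int p)"
    by (intro poly_eqI) (simp add: coeff_map_poly)
  then have "poly (map_poly of_int r) x = 0"
    using arg_cong[OF eq, of "\<lambda>t. poly (map_poly of_int t) x"] p(1) qx
    by (simp add: map_poly_of_int_add map_poly_of_int_mult)
  have "degree r \<le> 1"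
    using r q(1) by auto
  then have "r = [:coeff r 0, coeff r 1:]"
    by (intro poly_eqI) (auto simp: coeff_pCons coeff_eq_0 split: nat.splits)
  then obtain s t where st: "r = [:s, t:]"
    by blast
  have "of_int s + of_int t * x = 0"
    using \<open>poly (map_poly of_int r) x = 0\<close> by (simp add: st map_poly_pCons mult.commute)
  then have "r = 0"
    using of_int_linear_eq_0_iff[OF irr] st by auto
  \<comment> \<open>Multiplicativity of the content makes the pseudo-division factor
    \<open>e\<close> the content of \<open>h\<close> up to sign, so \<open>e\<close> cancels from
    \<open>smult e p = q * h\<close>.\<close>
  have "content p = 1"
    using content_dvd_coeff[of p "degree p"] p(2) by (metis is_unit_content_iff)
  moreover have "content q = 1"
    using prim by (simp only: q_def)
  ultimately have "content h = normalize e"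
    using arg_cong[OF eq, of content] \<open>r = 0\<close> by (simp add: content_mult)
  then have "[:e:] dvd h"
    by (simp add: const_poly_dvd_iff_dvd_content)
  then obtain h' where "h = smult e h'"
    by (metis dvd_def mult_pCons_left mult_zero_left pCons_0_0 add.right_neutral)
  moreover have "e \<noteq> 0"
    using \<open>a \<noteq> 0\<close> by (simp add: e_def)
  ultimately have "p = q * h'"
    using eq \<open>r = 0\<close> by (metis add.right_neutral mult_smult_right smult_cancel)
  then have "1 = a * lead_coeff h'"
    using p(2) q(2) by (metis lead_coeff_mult)
  then show ?thesis
    by (metis dvd_triv_left)
qed

text \<open>After division by the gcd, \<open>C'\<close> is coprime to \<open>n'\<close>, so its
  square must divide \<open>D\<close> itself.\<close>

lemma squarefree_square_dvd_mult_square: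
  fixes D C n :: nat
  assumes "squarefree D" "C\<^sup>2 dvd D * n\<^sup>2"
  shows "C dvd n"
proof (cases "C = 0 \<or> n = 0")
  case True
  with assms show ?thesis by (auto simp: squarefree_def)
next
  case False
  define g where "g = gcd C n"
  have "g \<noteq> 0" using False by (simp add: g_def)
  obtain C' n' where C': "C = C' * g" "n = n' * g" "coprime C' n'"
    using gcd_coprime_exists[of C n] \<open>g \<noteq> 0\<close> unfolding g_def by auto
  have "C'\<^sup>2 * g\<^sup>2 dvd (D * n'\<^sup>2) * g\<^sup>2"
    using assms(2) by (simp add: C' power_mult_distrib mult.assoc)
  then have "C'\<^sup>2 dvd D * n'\<^sup>2"
    using \<open>g \<noteq> 0\<close> by simp
  then have "C'\<^sup>2 dvd D"
    using \<open>coprime C' n'\<close> by (simp add: coprime_dvd_mult_left_iff)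
  then have "C' = 1"
    using squarefreeD[OF assms(1)] by auto
  with C' show ?thesis by simp
qed

lemma squarefree_sqrt_irrational:
  assumes "D \<ge> 2" "squarefree D"
  shows "sqrt (real D) \<notin> \<rat>"
proof
  assume "sqrt (real D) \<in> \<rat>"
  moreover have "algebraic_int (sqrt (real D))"
    by (intro algebraic_int_sqrt) auto
  ultimately have "sqrt (real D) \<in> \<int>"
    by (rule rational_algebraic_int_is_int[rotated])
  then obtain k where "sqrt (real D) = of_int k"
    by (auto elim: Ints_cases)
  then have "real D = (of_int k)\<^sup>2"
    by (metis of_nat_0_le_iff real_sqrt_pow2)
  then have "int D = k\<^sup>2"
    by (metis of_int_eq_iff of_int_of_nat_eq of_int_power)
  then have "D = (nat \<bar>k\<bar>)\<^sup>2"
    by (metis nat_abs_int_diff nat_int nat_power_eq abs_ge_zero power2_abs)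
  moreover from this have "nat \<bar>k\<bar> = 1"
    using squarefreeD[OF assms(2), of "nat \<bar>k\<bar>"] by simp
  ultimately show False
    using assms(1) by simp
qed

section \<open>The ring of integers in the basis 1, \<open>omega D\<close>\<close>

definition omega_conj :: "nat \<Rightarrow> real" where
  "omega_conj D = (if D mod 4 = 1 then (1 - sqrt (real D)) / 2 else - sqrt (real D))"

lemma algebraic_int_quadratic:
  fixes x :: real
  assumes "x\<^sup>2 + of_int b * x + of_int c = 0"
  shows "algebraic_int x"
  by (rule algebraic_int.intros[of "[:of_int c, of_int b, 1:]"])
    (use assms in \<open>auto simp: coeff_pCons algebra_simps power2_eq_square split: nat.splits\<close>)

lemma algebraic_int_omega_combination: "algebraic_int (of_int m + of_int n * omega D)"
proof -
  have "\<exists>e f :: int. (omega D)\<^sup>2 = of_int e * omega D + of_int f"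
  proof (cases "D mod 4 = 1")
    case True
    define j where "j = D div 4"
    have D: "D = 4 * j + 1"
      using True unfolding j_def by presburger
    have "(omega D)\<^sup>2 = of_int 1 * omega D + of_int (int j)"
      using True by (simp add: omega_def power_divide power2_sum D field_simps)
    then show ?thesis by blast
  next
    case False
    then have "(omega D)\<^sup>2 = of_int 0 * omega D + of_int (int D)"
      by (simp add: omega_def)
    then show ?thesis by blast
  qed
  then obtain e f :: int where ef: "(omega D)\<^sup>2 = of_int e * omega D + of_int f"
    by blast
  let ?x = "of_int m + of_int n * omega D"
  have "?x\<^sup>2 = (of_int m)\<^sup>2 + 2 * of_int m * of_int n * omega D + (of_int n)\<^sup>2 * (omega D)\<^sup>2"
    by (simp add: power2_sum power_mult_distrib)
  \<comment> \<open>The coefficients are minus the trace and the norm of \<open>?x\<close>, computed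
    from \<open>omega D\<close> being a root of \<open>X^2 - e X - f\<close>.\<close>
  then have "?x\<^sup>2 + of_int (- (2 * m + e * n)) * ?x + of_int (m\<^sup>2 + e * m * n - f * n\<^sup>2) = 0"
    unfolding ef by (simp add: algebra_simps power2_eq_square)
  then show ?thesis
    by (rule algebraic_int_quadratic)
qed

text \<open>
  Clearing denominators, \<open>x = (A + B \<surd>D) / C\<close> is a root of \<open>C\<^sup>2 X\<^sup>2 - 2 A C X + (A\<^sup>2 - D B\<^sup>2)\<close>, so
  integrality of \<open>x\<close> means that \<open>C\<^sup>2\<close> divides all three coefficients.
\<close>

lemma algebraic_int_quadratic_field_half:
  fixes r s :: rat
  assumes D: "D \<ge> 2" "squarefree D"
    and x: "x = of_rat r + of_rat s * sqrt (real D)" and alg: "algebraic_int x"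
  obtains m n :: int where "x = (of_int m + of_int n * sqrt (real D)) / 2"
    "r = of_int m / 2" "s = of_int n / 2" "4 dvd m\<^sup>2 - int D * n\<^sup>2"
proof (cases "s = 0")
  case True
  then have "x \<in> \<int>"
    using alg x by (intro rational_algebraic_int_is_int) auto
  then obtain k where "x = of_int k"
    by (auto elim: Ints_cases)
  then have "(of_rat r :: real) = of_rat (of_int k)"
    using True x by simp
  then have "r = of_int k"
    using of_rat_eq_iff by blast
  then show ?thesis
    using True x by (intro that[of "2 * k" 0]) (auto simp: power_mult_distrib)
next
  case False
  have irr: "sqrt (real D) \<notin> \<rat>"
    using D by (rule squarefree_sqrt_irrational)
  obtain a1 b1 where r1: "r = of_int a1 / of_int b1" "b1 > 0"
    by (metis quotient_of_denom_pos quotient_of_div surj_pair)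
  obtain a2 b2 where s1: "s = of_int a2 / of_int b2" "b2 > 0"
    by (metis quotient_of_denom_pos quotient_of_div surj_pair)
  define A B C where "A = a1 * b2" and "B = a2 * b1" and "C = b1 * b2"
  have C0: "C > 0" and r: "r = of_int A / of_int C" and s: "s = of_int B / of_int C"
    using r1 s1 by (auto simp: A_def B_def C_def)
  have xe: "of_int C * x = of_int A + of_int B * sqrt (real D)"
    using C0 by (simp add: x r s of_rat_divide field_simps)
  have xirr: "x \<notin> \<rat>"
  proof
    assume "x \<in> \<rat>"
    then have "(x - of_rat r) / of_rat s \<in> \<rat>"
      by (intro Rats_divide Rats_diff Rats_of_rat)
    moreover have "(x - of_rat r) / of_rat s = sqrt (real D)"
      using False by (simp add: x)
    ultimately show False using irr by simp
  qed
  \<comment> \<open>The content \<open>g\<close> is divided out first: the primitive part has a unit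
    \<open>a\<close> as leading coefficient, so \<open>C^2 = g * a\<close> shows that
    \<open>C^2\<close> divides \<open>g\<close>.\<close>
  define P where "P = [:A\<^sup>2 - int D * B\<^sup>2, - 2 * A * C, C\<^sup>2:]"
  define g where "g = content P"
  have "P \<noteq> 0" using C0 by (simp add: P_def)
  then have "g \<noteq> 0" by (simp add: g_def)
  obtain c b a where pp: "primitive_part P = [:c, b, a:]" and
    Pc: "A\<^sup>2 - int D * B\<^sup>2 = g * c" "- 2 * A * C = g * b" "C\<^sup>2 = g * a"
  proof -
    have "degree (primitive_part P) = 2"
      using C0 by (simp add: P_def)
    then have e: "primitive_part P = [:coeff (primitive_part P) 0, coeff (primitive_part P) 1, coeff (primitive_part P) 2:]"
      by (intro poly_eqI) (auto simp: coeff_pCons coeff_eq_0 numeral_2_eq_2 split: nat.splits)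
    have "P = smult g (primitive_part P)"
      by (simp add: g_def)
    then have "coeff P i = g * coeff (primitive_part P) i" for i
      by (metis coeff_smult)
    from this[of 0] this[of 1] this[of 2] e show thesis
      by (intro that) (auto simp: P_def numeral_2_eq_2)
  qed
  have "(of_int C)\<^sup>2 * x\<^sup>2 + of_int (- 2 * A * C) * x + of_int (A\<^sup>2 - int D * B\<^sup>2) = 0"
  proof -
    have "(of_int C * x - of_int A)\<^sup>2 = (of_int B)\<^sup>2 * real D"
      unfolding xe by (simp add: power_mult_distrib)
    then show ?thesis
      by (simp add: power2_diff power_mult_distrib algebra_simps)
  qed
  then have "of_int (C\<^sup>2) * x\<^sup>2 + of_int (- 2 * A * C) * x + of_int (A\<^sup>2 - int D * B\<^sup>2) = 0"
    by (simp only: of_int_power)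
  then have "of_int g * (of_int a * x\<^sup>2 + of_int b * x + of_int c) = 0"
    unfolding Pc by (simp only: of_int_mult) (simp add: algebra_simps)
  then have root: "of_int a * x\<^sup>2 + of_int b * x + of_int c = 0"
    using \<open>g \<noteq> 0\<close> by simp
  have "content [:c, b, a:] = 1"
    using content_primitive_part[OF \<open>P \<noteq> 0\<close>] pp by simp
  then have "a dvd 1"
    using algebraic_int_primitive_quadratic_lead_unit[OF alg xirr root] by blast
  then have gC: "C\<^sup>2 dvd g"
    unfolding Pc(3) by (metis dvd_refl mult.right_neutral mult_dvd_mono)
  have "C * C dvd (2 * A) * C"
    using gC Pc(2) by (metis dvd_minus_iff dvd_mult2 minus_mult_left power2_eq_square)
  then have "C dvd 2 * A"
    using C0 by simp
  then obtain m where m: "2 * A = C * m" ..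
  have norm: "C\<^sup>2 dvd A\<^sup>2 - int D * B\<^sup>2"
    using gC Pc(1) by simp
  \<comment> \<open>The factor 4 permits replacing \<open>2 * A\<close> by \<open>C * m\<close>, so
    that \<open>C^2\<close> divides \<open>D * (2 * B)^2\<close>; squarefreeness of \<open>D\<close>
    then yields \<open>C dvd 2 * B\<close>.\<close>
  have "C\<^sup>2 dvd 4 * (A\<^sup>2 - int D * B\<^sup>2)"
    using norm by (rule dvd_mult)
  also have "4 * (A\<^sup>2 - int D * B\<^sup>2) = C\<^sup>2 * m\<^sup>2 - int D * (2 * B)\<^sup>2"
    using arg_cong[OF m, of "\<lambda>t. t\<^sup>2"] by (simp add: power_mult_distrib algebra_simps)
  finally have "C\<^sup>2 dvd int D * (2 * B)\<^sup>2"
    by (metis dvd_diff_right_iff dvd_triv_left)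
  then have "(nat C)\<^sup>2 dvd D * (nat \<bar>2 * B\<bar>)\<^sup>2"
    using C0 by (subst of_nat_dvd_iff[symmetric, where ?'a = int]) simp
  then have "nat C dvd nat \<bar>2 * B\<bar>"
    by (rule squarefree_square_dvd_mult_square[OF D(2)])
  then have "C dvd 2 * B"
    using C0 by (simp add: nat_dvd_iff)
  then obtain n where n: "2 * B = C * n" ..
  have "C\<^sup>2 * 4 dvd 4 * (A\<^sup>2 - int D * B\<^sup>2)"
    using norm by (metis mult.commute mult_dvd_mono dvd_refl)
  also have "4 * (A\<^sup>2 - int D * B\<^sup>2) = (2 * A)\<^sup>2 - int D * (2 * B)\<^sup>2"
    by (simp add: power_mult_distrib algebra_simps)
  also have "\<dots> = C\<^sup>2 * (m\<^sup>2 - int D * n\<^sup>2)"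
    unfolding m n by (simp add: power_mult_distrib algebra_simps)
  finally have 4: "4 dvd m\<^sup>2 - int D * n\<^sup>2"
    using C0 by simp
  have "(2 * of_int A :: rat) = of_int C * of_int m" "(2 * of_int B :: rat) = of_int C * of_int n"
    using m n by (metis of_int_mult of_int_numeral)+
  then have rs: "r = of_int m / 2" "s = of_int n / 2"
    using C0 by (auto simp: r s field_simps)
  then have "x = (of_int m + of_int n * sqrt (real D)) / 2"
    unfolding x rs by (simp add: of_rat_divide add_divide_distrib)
  then show ?thesis
    using that rs 4 by blast
qed

text \<open>Squares modulo 4 depend only on parity, so it suffices to compare the remainders
  \<open>e\<close> and \<open>f\<close> modulo 2.\<close>

lemma square_cong_mod_4_parity:
  fixes m n :: int
  assumes "4 dvd m\<^sup>2 - int D * n\<^sup>2" "D mod 4 \<noteq> 0"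
  shows "if D mod 4 = 1 then even (m - n) else even m \<and> even n"
proof -
  obtain d where d: "int D = 4 * d + int (D mod 4)"
    by (metis div_mod_decomp_int mult.commute of_nat_numeral zmod_int)
  have D4: "D mod 4 = 1 \<or> D mod 4 = 2 \<or> D mod 4 = 3"
    using assms(2) by linarith
  obtain i e where m: "m = 2 * i + e" "e = 0 \<or> e = 1"
    by (metis mod_mult_div_eq add.commute not_mod_2_eq_0_eq_1)
  obtain j f where n: "n = 2 * j + f" "f = 0 \<or> f = 1"
    by (metis mod_mult_div_eq add.commute not_mod_2_eq_0_eq_1)
  have "m\<^sup>2 - int D * n\<^sup>2 = 4 * (i\<^sup>2 + i * e - d * n\<^sup>2 - int (D mod 4) * (j\<^sup>2 + j * f))
          + (e\<^sup>2 - int (D mod 4) * f\<^sup>2)"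
    by (subst d) (simp add: m(1) n(1) algebra_simps power2_eq_square)
  with assms(1) have "4 dvd e\<^sup>2 - int (D mod 4) * f\<^sup>2"
    by (metis dvd_add_right_iff dvd_triv_left)
  with D4 m n show ?thesis
    by auto
qed

text \<open>Integrality makes the rational coordinates half-integers, and the congruence modulo 4
  absorbs the halves into \<open>omega D\<close>. All later arguments use these integer
  coordinates.\<close>

lemma totally_positive_integers_eq:
  assumes D: "D \<ge> 2" "squarefree D"
  shows "totally_positive_integers D = {of_int m + of_int n * omega D | m n :: int.
    of_int m + of_int n * omega D > 0 \<and> of_int m + of_int n * omega_conj D > 0}"
    (is "_ = ?R")
proof (intro set_eqI iffI)
  fix x assume "x \<in> totally_positive_integers D"
  then have alg: "algebraic_int x" and "totally_positive D x"
    by (auto simp: totally_positive_integers_def)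
  then obtain r s where x: "x = of_rat r + of_rat s * sqrt (real D)"
    and pos: "of_rat r + of_rat s * sqrt (real D) > 0" "of_rat r - of_rat s * sqrt (real D) > 0"
    unfolding totally_positive_def by blast
  obtain m n :: int where mn: "x = (of_int m + of_int n * sqrt (real D)) / 2"
    "r = of_int m / 2" "s = of_int n / 2" "4 dvd m\<^sup>2 - int D * n\<^sup>2"
    using algebraic_int_quadratic_field_half[OF D x alg] .
  have pos': "of_int m + of_int n * sqrt (real D) > 0" "of_int m - of_int n * sqrt (real D) > 0"
    using pos by (auto simp: mn of_rat_divide)
  have "D mod 4 \<noteq> 0"
  proof
    assume "D mod 4 = 0"
    then have "2\<^sup>2 dvd D" by auto
    then show False using squarefreeD[OF D(2), of 2] by simp
  qed
  from square_cong_mod_4_parity[OF mn(4) this]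
  have par: "if D mod 4 = 1 then even (m - n) else even m \<and> even n" .
  show "x \<in> ?R"
  proof (cases "D mod 4 = 1")
    case True
    \<comment> \<open>\<open>(m + n * sqrt D) / 2\<close> equals \<open>k + n * omega D\<close>
      exactly when \<open>m = 2 * k + n\<close>.\<close>
    then obtain k where "m = 2 * k + n"
      using par by (metis add.commute diff_add_cancel dvd_def)
    then have "x = of_int k + of_int n * omega D \<and> of_int k + of_int n * omega D > 0 \<and>
        of_int k + of_int n * omega_conj D > 0"
      using True pos' mn(1) by (simp add: omega_def omega_conj_def field_simps)
    then show ?thesis by blast
  next
    case False
    then obtain k l where "m = 2 * k" "n = 2 * l"
      using par by (auto elim!: evenE)
    then have "x = of_int k + of_int l * omega D \<and> of_int k + of_int l * omega D > 0 \<and>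
        of_int k + of_int l * omega_conj D > 0"
      using False pos' mn(1) by (simp add: omega_def omega_conj_def field_simps)
    then show ?thesis by blast
  qed
next
  fix x assume "x \<in> ?R"
  then obtain m n :: int where x: "x = of_int m + of_int n * omega D"
    and pos: "of_int m + of_int n * omega D > 0" "of_int m + of_int n * omega_conj D > 0"
    by blast
  have alg: "algebraic_int x"
    unfolding x by (rule algebraic_int_omega_combination)
  have "\<exists>r s. x = of_rat r + of_rat s * sqrt (real D) \<and>
      of_int m + of_int n * omega_conj D = of_rat r - of_rat s * sqrt (real D)"
  proof (cases "D mod 4 = 1")
    case True
    show ?thesis
      by (rule exI[where x = "of_int m + of_int n / 2"], rule exI[where x = "of_int n / 2"])
        (use True in \<open>simp add: x omega_def omega_conj_def of_rat_add of_rat_divide diff_divide_distrib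
          add_divide_distrib algebra_simps\<close>)
  next
    case False
    show ?thesis
      by (rule exI[where x = "of_int m"], rule exI[where x = "of_int n"])
        (use False in \<open>simp add: x omega_def omega_conj_def\<close>)
  qed
  then obtain r s where "x = of_rat r + of_rat s * sqrt (real D)"
      "of_int m + of_int n * omega_conj D = of_rat r - of_rat s * sqrt (real D)"
    by blast
  then show "x \<in> totally_positive_integers D"
    using alg pos x unfolding totally_positive_integers_def quadratic_field_def totally_positive_def
    by auto
qed

section \<open>Partitions in a totally positive cone\<close>

text \<open>\<open>E'\<close> and \<open>F'\<close> stand for the conjugates of \<open>E\<close> and
  \<open>F\<close>, and \<open>T\<close> for the totally positive integers. The counting depends
  only on the signs and on \<open>E' < F'\<close>, so it is kept apart from the arithmetic of the
  field.\<close>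

locale adapted_basis =
  fixes E F E' F' :: real and T :: "real set"
  assumes T_eq: "T = {of_int x * E + of_int y * F | x y :: int.
        of_int x * E + of_int y * F > 0 \<and> of_int x * E' + of_int y * F' > 0}"
    and unique: "\<And>x y :: int. of_int x * E + of_int y * F = 0 \<Longrightarrow> x = 0 \<and> y = 0"
    and E_pos: "E > 0" and F_neg: "F < 0" and E'_pos: "E' > 0" and E'_less_F': "E' < F'"
begin

definition pt :: "int \<Rightarrow> int \<Rightarrow> real" where
  "pt x y = of_int x * E + of_int y * F"

lemma pt_eq_iff: "pt x y = pt z w \<longleftrightarrow> x = z \<and> y = w"
proof
  assume "pt x y = pt z w"
  then have "of_int (x - z) * E + of_int (y - w) * F = 0"
    by (simp add: pt_def algebra_simps)
  then show "x = z \<and> y = w"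
    using unique[of "x - z" "y - w"] by auto
qed simp

lemma pt_add: "pt x y + pt z w = pt (x + z) (y + w)"
  by (simp add: pt_def algebra_simps)

text \<open>A coordinate \<open>x \<le> 0\<close> would force \<open>y * F\<close> and
  \<open>y * F'\<close> to be both positive, against \<open>F < 0 < F'\<close>.\<close>

lemma T_cases:
  assumes "v \<in> T"
  obtains x y where "v = pt x y" "x \<ge> 1" "of_int x * E' + of_int y * F' > 0"
proof -
  obtain x y :: int where v: "v = pt x y" and pos: "of_int x * E + of_int y * F > 0"
      "of_int x * E' + of_int y * F' > 0"
    using assms unfolding T_eq pt_def by blast
  have "x \<ge> 1"
  proof (rule ccontr)
    assume "\<not> x \<ge> 1"
    then have x: "real_of_int x \<le> 0" by simp
    have F': "F' > 0" using E'_pos E'_less_F' by simp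
    have "of_int x * E' \<le> 0" "of_int x * E \<le> 0"
      using x E'_pos E_pos by (auto intro: mult_nonpos_nonneg)
    with pos have "of_int y * F > 0" "of_int y * F' > 0" by linarith+
    then show False
      using F_neg F' by (auto simp: zero_less_mult_iff)
  qed
  with v pos that show thesis by blast
qed

text \<open>Since \<open>E' < F'\<close>, already \<open>y = -1\<close> makes the conjugate
  \<open>E' + y * F'\<close> negative.\<close>

lemma T_1_cases:
  assumes "pt 1 y \<in> T"
  shows "y \<ge> 0"
proof -
  obtain x z where xz: "pt 1 y = pt x z" "of_int x * E' + of_int z * F' > 0"
    using T_cases[OF assms] by metis
  then have "E' + of_int y * F' > 0" by (auto simp: pt_eq_iff)
  moreover have "of_int y * F' \<le> (- 1) * F'" if "y < 0"
    using that E'_pos E'_less_F' by (intro mult_right_mono) auto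
  ultimately show ?thesis
    using E'_less_F' by fastforce
qed

lemma pt_in_T:
  assumes "of_int x * E + of_int y * F > 0" "of_int x * E' + of_int y * F' > 0"
  shows "pt x y \<in> T"
  unfolding T_eq pt_def using assms by blast

lemma pt_1_in_T:
  assumes "0 \<le> a" "E + of_int a * F > 0"
  shows "pt 1 a \<in> T"
proof -
  have "E' + of_int a * F' > 0"
    using assms(1) E'_pos E'_less_F' by (intro add_pos_nonneg) auto
  then show ?thesis
    using assms(2) by (intro pt_in_T) auto
qed

text \<open>The first coordinate is additive and at least 1 on \<open>T\<close>, so it bounds the
  number of parts.\<close>

lemma sum_mset_T:
  assumes "set_mset M \<subseteq> T"
  obtains x y where "\<Sum>\<^sub># M = pt x y" "x \<ge> int (size M)"
proof -
  have "\<exists>x y. \<Sum>\<^sub># M = pt x y \<and> x \<ge> int (size M)"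
    using assms
  proof (induction M)
    case empty
    show ?case by (intro exI[of _ 0]) (simp add: pt_def)
  next
    case (add v M)
    then obtain x y where "\<Sum>\<^sub># M = pt x y" "x \<ge> int (size M)" by auto
    moreover obtain z w where "v = pt z w" "z \<ge> 1"
      using add.prems T_cases by (metis insert_subset set_mset_add_mset_insert)
    ultimately have "\<Sum>\<^sub># (add_mset v M) = pt (z + x) (w + y)" "z + x \<ge> int (size (add_mset v M))"
      by (auto simp: pt_add)
    then show ?case by blast
  qed
  with that show thesis by blast
qed

lemma partitions_of_pt_size:
  assumes "set_mset M \<subseteq> T" "\<Sum>\<^sub># M = pt n k"
  shows "int (size M) \<le> n"
  using sum_mset_T[OF assms(1)] assms(2) pt_eq_iff by metis

text \<open>Indecomposability of \<open>E\<close>; it supplies the value 1, which lies below every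
  value coming from \<open>2 E + k F\<close>.\<close>

lemma partitions_E: "{M. M \<noteq> {#} \<and> set_mset M \<subseteq> T \<and> \<Sum>\<^sub># M = pt 1 0} = {{#pt 1 0#}}"
proof -
  have "pt 1 0 \<in> T"
    using E_pos by (intro pt_1_in_T) auto
  moreover have "M = {#pt 1 0#}" if "M \<noteq> {#}" "set_mset M \<subseteq> T" "\<Sum>\<^sub># M = pt 1 0" for M
  proof -
    have "size M = 1"
      using partitions_of_pt_size[OF that(2,3)] that(1) by (simp add: Suc_leI le_antisym nonempty_has_size)
    then obtain v where "M = {#v#}" using size_1_singleton_mset by blast
    with that(3) show ?thesis by simp
  qed
  ultimately show ?thesis by auto
qed

text \<open>As \<open>F < 0\<close>, the hypothesis makes \<open>E + a F\<close> positive for all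
  \<open>a\<close> from 0 to \<open>k\<close>. There are \<open>k div 2 + 1\<close> unordered pairs,
  and the one-part partition adds one.\<close>

lemma card_partitions_2E_kF:
  fixes k :: nat
  assumes k: "E + of_nat k * F > 0"
  shows "pt 2 (int k) \<in> T"
    and "card {M. M \<noteq> {#} \<and> set_mset M \<subseteq> T \<and> \<Sum>\<^sub># M = pt 2 (int k)} = k div 2 + 2"
proof -
  \<comment> \<open>Restricting \<open>a\<close> to at most \<open>k div 2\<close> selects one
    representative of each unordered pair \<open>{a, k - a}\<close>.\<close>
  define f where "f a = {#pt 1 (int a), pt 1 (int k - int a)#}" for a
  have in_T: "pt 1 a \<in> T" if "0 \<le> a" "a \<le> int k" for a
  proof -
    have "of_nat k * F \<le> of_int a * F"
      using that F_neg by (intro mult_right_mono_neg) linarith+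
    with k that show ?thesis by (intro pt_1_in_T) auto
  qed
  show T2: "pt 2 (int k) \<in> T"
  proof -
    have "2 * E + of_int (int k) * F > 0"
      using k E_pos by simp
    moreover have "2 * E' + of_int (int k) * F' > 0"
      using E'_pos E'_less_F' by (intro add_pos_nonneg) auto
    ultimately show ?thesis
      by (intro pt_in_T) auto
  qed
  have "{M. M \<noteq> {#} \<and> set_mset M \<subseteq> T \<and> \<Sum>\<^sub># M = pt 2 (int k)} =
      insert {#pt 2 (int k)#} (f ` {0..k div 2})" (is "?L = ?R")
  proof (intro subset_antisym subsetI)
    fix M assume "M \<in> ?L"
    then have M: "M \<noteq> {#}" "set_mset M \<subseteq> T" "\<Sum>\<^sub># M = pt 2 (int k)" by auto
    have "size M \<le> 2" "size M > 0"
      using partitions_of_pt_size[OF M(2,3)] M(1) by (auto simp: nonempty_has_size)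
    then consider "size M = 1" | "size M = 2" by linarith
    then show "M \<in> ?R"
    proof cases
      case 1
      then obtain v where "M = {#v#}" using size_1_singleton_mset by blast
      with M(3) show ?thesis by simp
    next
      case 2
      then obtain v N where N: "M = add_mset v N"
        using size_eq_Suc_imp_eq_union[of M 1] by auto
      then obtain w where "N = {#w#}"
        using 2 size_1_singleton_mset[of N] by auto
      with N have vw: "M = {#v, w#}" by simp
      then have "v \<in> T" "w \<in> T" using M(2) by auto
      then obtain x y x' y' where v: "v = pt x y" "x \<ge> 1" and w: "w = pt x' y'" "x' \<ge> 1"
        using T_cases by metis
      have "x + x' = 2" "y + y' = int k"
        using M(3) vw v w by (auto simp: pt_add pt_eq_iff)
      then have x: "x = 1" "x' = 1" using v w by auto
      have "y \<ge> 0" "y' \<ge> 0"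
        using \<open>v \<in> T\<close> \<open>w \<in> T\<close> v w x T_1_cases by auto
      show ?thesis
      proof (cases "y \<le> y'")
        case True
        have "M = f (nat y)" "nat y \<in> {0..k div 2}"
          using True \<open>y \<ge> 0\<close> \<open>y + y' = int k\<close>
          by (auto simp: vw v w x f_def pt_eq_iff)
        then show ?thesis by blast
      next
        case False
        have "M = f (nat y')" "nat y' \<in> {0..k div 2}"
          using False \<open>y' \<ge> 0\<close> \<open>y + y' = int k\<close>
          by (auto simp: vw v w x f_def pt_eq_iff add_mset_commute)
        then show ?thesis by blast
      qed
    qed
  next
    fix M assume "M \<in> ?R"
    then show "M \<in> ?L"
    proof
      assume "M = {#pt 2 (int k)#}"
      then show ?thesis using T2 by simp
    next
      assume "M \<in> f ` {0..k div 2}"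
      then obtain a where "a \<le> k div 2" "M = f a" by auto
      then show ?thesis
        using in_T[of "int a"] in_T[of "int k - int a"] by (auto simp: f_def pt_add)
    qed
  qed
  moreover have "inj_on f {0..k div 2}"
  proof (rule inj_onI)
    fix a b assume ab: "a \<in> {0..k div 2}" "b \<in> {0..k div 2}" and "f a = f b"
    then have "pt 1 (int a) \<in># f b"
      by (metis f_def union_single_eq_member add_mset_add_single)
    \<comment> \<open>In the second alternative \<open>a + b = k\<close> with both at most
      \<open>k div 2\<close>, which again forces \<open>a = b\<close>.\<close>
    then have "int a = int b \<or> int a = int k - int b"
      by (auto simp: f_def pt_eq_iff)
    with ab show "a = b" by auto
  qed
  moreover have "{#pt 2 (int k)#} \<notin> f ` {0..k div 2}"
    by (auto simp: f_def)
  ultimately show "card {M. M \<noteq> {#} \<and> set_mset M \<subseteq> T \<and> \<Sum>\<^sub># M = pt 2 (int k)} = k div 2 + 2"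
    by (simp add: card_image)
qed

end

section \<open>Continued fractions\<close>

lemma frac_irrational:
  assumes "x \<notin> \<rat>"
  shows "0 < frac x" "frac x < 1" "1 / frac x \<notin> \<rat>"
proof -
  have "x \<notin> \<int>" using assms Ints_subset_Rats by blast
  then show "0 < frac x" by (simp add: frac_gt_0_iff)
  show "frac x < 1" by (rule frac_lt_1)
  show "1 / frac x \<notin> \<rat>"
  proof
    assume "1 / frac x \<in> \<rat>"
    then have "1 / (1 / frac x) + of_int \<lfloor>x\<rfloor> \<in> \<rat>"
      by (rule Rats_add[OF Rats_divide[OF Rats_1] Rats_of_int])
    moreover have "1 / (1 / frac x) + of_int \<lfloor>x\<rfloor> = x"
      by (simp add: frac_def)
    ultimately show False using assms by metis
  qed
qed

lemma complete_quotient_irrational: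
  assumes "x \<notin> \<rat>"
  shows "complete_quotient x n \<notin> \<rat>"
  by (induction n) (use assms frac_irrational(3) in auto)

lemma complete_quotient_Suc_gt_1:
  assumes "x \<notin> \<rat>"
  shows "complete_quotient x (Suc n) > 1"
  using frac_irrational(1,2)[OF complete_quotient_irrational[OF assms, of n]] by simp

text \<open>
  Here \<open>a + b x\<close> and \<open>c + d x\<close> are \<open>\<alpha>\<^sub>n\<^sub>-\<^sub>1\<close> and \<open>\<alpha>\<^sub>n\<close> from the introduction; \<open>x'\<close> plays the role of the
  conjugate of \<open>x\<close>.
\<close>

lemma convergent_basis:
  fixes x x' :: real
  assumes irr: "x \<notin> \<rat>" and x': "of_int \<lfloor>x\<rfloor> - x' > 1"
  shows "\<exists>a b c d :: int. \<bar>a * d - b * c\<bar> = 1 \<and>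
    0 < (- 1) ^ n * (of_int a + of_int b * x) \<and>
    of_int c + of_int d * x = - (of_int a + of_int b * x) / complete_quotient x (Suc n) \<and>
    0 < of_int a + of_int b * x' \<and> of_int a + of_int b * x' < of_int c + of_int d * x'"
proof (induction n)
  case 0
  \<comment> \<open>The starting pair is 1 and \<open>\<lfloor>x\<rfloor> - x\<close>, from the
    formal convergent \<open>1/0\<close> and the convergent \<open>\<lfloor>x\<rfloor>/1\<close>;
    the assumption on \<open>x'\<close> orders their conjugates.\<close>
  have "of_int \<lfloor>x\<rfloor> + of_int (- 1) * x = - 1 / complete_quotient x (Suc 0)"
    by (simp add: frac_def)
  then show ?case
    using x' by (intro exI[of _ 1] exI[of _ 0] exI[of _ "\<lfloor>x\<rfloor>"] exI[of _ "- 1"]) auto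
next
  case (Suc n)
  then obtain a b c d :: int where det: "\<bar>a * d - b * c\<bar> = 1"
    and sgn: "0 < (- 1) ^ n * (of_int a + of_int b * x)"
    and q: "of_int c + of_int d * x = - (of_int a + of_int b * x) / complete_quotient x (Suc n)"
    and pos: "0 < of_int a + of_int b * x'"
    and less: "of_int a + of_int b * x' < of_int c + of_int d * x'"
    by blast
  define z where "z = complete_quotient x (Suc n)"
  \<comment> \<open>\<open>k\<close> is the next partial quotient, and the new element is the old
    first one plus \<open>k\<close> times the second, as in the recurrence for convergents.\<close>
  define k where "k = \<lfloor>z\<rfloor>"
  have z: "z > 1" "z \<notin> \<rat>"
    using complete_quotient_Suc_gt_1[OF irr] complete_quotient_irrational[OF irr]
    unfolding z_def by blast+
  have k: "k \<ge> 1" using z by (simp add: k_def le_floor_iff)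
  have det': "\<bar>c * (b + k * d) - d * (a + k * c)\<bar> = 1"
    using det by (simp add: algebra_simps)
  have sgn': "0 < (- 1) ^ Suc n * (of_int c + of_int d * x)"
  proof -
    have flip: "(- 1) ^ Suc n * (- t / z) = (- 1) ^ n * t / z" for t :: real
      by simp
    show ?thesis
      unfolding q z_def[symmetric] flip using sgn z(1) by (intro divide_pos_pos) linarith+  qed
  have ab: "of_int a + of_int b * x = - z * (of_int c + of_int d * x)"
    using q z unfolding z_def[symmetric] by simp
  have "of_int (a + k * c) + of_int (b + k * d) * x
      = (of_int a + of_int b * x) + of_int k * (of_int c + of_int d * x)"
    by (simp add: algebra_simps)
  \<comment> \<open>\<open>z - k = frac z\<close> is the reciprocal of the next complete quotient,
    so the ratio keeps its shape one step on.\<close>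
  also have "\<dots> = - frac z * (of_int c + of_int d * x)"
    unfolding ab by (simp add: frac_def k_def algebra_simps)
  also have "\<dots> = - (of_int c + of_int d * x) / complete_quotient x (Suc (Suc n))"
    by (simp add: z_def algebra_simps)
  finally have q': "of_int (a + k * c) + of_int (b + k * d) * x
      = - (of_int c + of_int d * x) / complete_quotient x (Suc (Suc n))" .
  have cd: "0 < of_int c + of_int d * x'" using pos less by linarith
  \<comment> \<open>\<open>k \<ge> 1\<close> and positivity of the earlier conjugate keep the
    conjugates strictly increasing.\<close>
  have "1 * (of_int c + of_int d * x') \<le> of_int k * (of_int c + of_int d * x')"
    using k cd by (intro mult_right_mono) auto
  then have "of_int c + of_int d * x' < of_int (a + k * c) + of_int (b + k * d) * x'"
    using pos by (simp add: algebra_simps)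
  then show ?case
    by (rule_tac x = c in exI, rule_tac x = d in exI, rule_tac x = "a + k * c" in exI,
        rule_tac x = "b + k * d" in exI) (intro conjI det' sgn' q' cd)
qed

section \<open>Specialization to \<open>omega D\<close>, with periodicity and unimodular changes of
  basis\<close>

lemma omega_irrational:
  assumes "D \<ge> 2" "squarefree D"
  shows "omega D \<notin> \<rat>"
proof
  assume "omega D \<in> \<rat>"
  then have "2 * omega D - 1 \<in> \<rat>" by (intro Rats_diff Rats_mult) auto
  moreover have "sqrt (real D) = (if D mod 4 = 1 then 2 * omega D - 1 else omega D)"
    by (simp add: omega_def field_simps)
  ultimately show False
    using squarefree_sqrt_irrational[OF assms] \<open>omega D \<in> \<rat>\<close> by (auto split: if_splits)
qed

text \<open>Feeds the base case of \<open>convergent_basis\<close>; it holds since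
  \<open>omega D > 1\<close> while its conjugate is negative.\<close>

lemma floor_omega_minus_conj:
  assumes "D \<ge> 2"
  shows "of_int \<lfloor>omega D\<rfloor> - omega_conj D > 1"
proof -
  have "1 < sqrt (real D)" using assms by simp
  then have "1 < omega D" "omega_conj D < 0"
    by (auto simp: omega_def omega_conj_def)
  then have "of_int \<lfloor>omega D\<rfloor> \<ge> (1 :: real)"
    by simp
  with \<open>omega_conj D < 0\<close> show ?thesis by linarith
qed

text \<open>Ensures that the maximum \<open>B\<close> is attained: every index can be shifted back
  by periods into \<open>{1..s}\<close>.\<close>

lemma periodic_range_finite:
  fixes u :: "nat \<Rightarrow> 'a"
  assumes "s \<ge> 1" "\<forall>i\<ge>1. u (i + s) = u i"
  shows "finite (u ` {1..})"
proof -
  have "u i \<in> u ` {1..s}" if "i \<ge> 1" for i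
    using that
  proof (induction i rule: less_induct)
    case (less i)
    show ?case
    proof (cases "i \<le> s")
      case True
      with less show ?thesis by auto
    next
      case False
      then have "u (i - s) = u i" using assms(2)[rule_format, of "i - s"] by simp
      with less.IH[of "i - s"] False assms(1) show ?thesis by auto
    qed
  qed
  then have "u ` {1..} \<subseteq> u ` {1..s}" by auto
  then show ?thesis using finite_surj by blast
qed

text \<open>Cramer's rule; the determinant \<open>e\<close> is 1 or -1, hence its own
  inverse.\<close>

lemma unimodular_coordinates:
  fixes a b c d m n :: int
  assumes "\<bar>a * d - b * c\<bar> = 1"
  obtains x y where "m = x * a + y * c" "n = x * b + y * d"
proof -
  define e where "e = a * d - b * c"
  have e: "e * e = 1" using assms unfolding e_def[symmetric] by (auto simp: abs_if split: if_splits)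
  have "(e * (m * d - n * c)) * a + (e * (n * a - m * b)) * c = e * e * m"
       "(e * (m * d - n * c)) * b + (e * (n * a - m * b)) * d = e * e * n"
    by (simp_all add: e_def algebra_simps)
  with e that show thesis by (metis mult_1)
qed

text \<open>Evenness of \<open>n\<close> makes \<open>E\<close> positive. The formula for
  \<open>F\<close> is exported because it turns \<open>E + k F > 0\<close> into the condition that
  \<open>k\<close> is less than the complete quotient.\<close>

lemma adapted_basis_convergents:
  assumes D: "D \<ge> 2" "squarefree D" and n: "even n"
  obtains E F E' F' where "adapted_basis E F E' F' (totally_positive_integers D)"
    "F = - E / complete_quotient (omega D) (Suc n)"
proof -
  let ?w = "omega D" and ?w' = "omega_conj D"
  obtain a b c d :: int where det: "\<bar>a * d - b * c\<bar> = 1"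
    and sgn: "0 < (- 1) ^ n * (of_int a + of_int b * ?w)"
    and q: "of_int c + of_int d * ?w = - (of_int a + of_int b * ?w) / complete_quotient ?w (Suc n)"
    and pos: "0 < of_int a + of_int b * ?w'"
    and less: "of_int a + of_int b * ?w' < of_int c + of_int d * ?w'"
    using convergent_basis[OF omega_irrational[OF D] floor_omega_minus_conj[OF D(1)]] by blast
  have comb: "of_int x * (of_int a + of_int b * t) + of_int y * (of_int c + of_int d * t)
      = of_int (x * a + y * c) + of_int (x * b + y * d) * t" for x y and t :: real
    by (simp add: algebra_simps)
  have "adapted_basis (of_int a + of_int b * ?w) (of_int c + of_int d * ?w)
      (of_int a + of_int b * ?w') (of_int c + of_int d * ?w') (totally_positive_integers D)"
  proof
    show "totally_positive_integers D = {of_int x * (of_int a + of_int b * ?w) +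
         of_int y * (of_int c + of_int d * ?w) | x y :: int.
        of_int x * (of_int a + of_int b * ?w) + of_int y * (of_int c + of_int d * ?w) > 0 \<and>
        of_int x * (of_int a + of_int b * ?w') + of_int y * (of_int c + of_int d * ?w') > 0}"
      unfolding comb totally_positive_integers_eq[OF D]
    proof (intro subset_antisym subsetI)
      fix v assume "v \<in> {of_int m + of_int n * ?w | m n :: int.
        of_int m + of_int n * ?w > 0 \<and> of_int m + of_int n * ?w' > 0}"
      then obtain m n :: int where mn: "v = of_int m + of_int n * ?w"
        "of_int m + of_int n * ?w > 0" "of_int m + of_int n * ?w' > 0"
        by blast
      obtain x y where "m = x * a + y * c" "n = x * b + y * d"
        using unimodular_coordinates[OF det] .
      with mn show "v \<in> {of_int (x * a + y * c) + of_int (x * b + y * d) * ?w | x y :: int.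
        of_int (x * a + y * c) + of_int (x * b + y * d) * ?w > 0 \<and>
        of_int (x * a + y * c) + of_int (x * b + y * d) * ?w' > 0}"
        by blast
    qed blast
  next
    fix x y :: int
    assume "of_int x * (of_int a + of_int b * ?w) + of_int y * (of_int c + of_int d * ?w) = 0"
    then have "x * a + y * c = 0" "x * b + y * d = 0"
      unfolding comb of_int_linear_eq_0_iff[OF omega_irrational[OF D]] by auto
    moreover have "(a * d - b * c) * x = (x * a + y * c) * d - (x * b + y * d) * c"
      "(a * d - b * c) * y = (x * b + y * d) * a - (x * a + y * c) * b"
      by (simp_all add: algebra_simps)
    ultimately show "x = 0 \<and> y = 0"
      using det by auto
  next
    show E: "0 < of_int a + of_int b * ?w"
      using sgn n by simp
    show "of_int c + of_int d * ?w < 0"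
      using E complete_quotient_Suc_gt_1[OF omega_irrational[OF D], of n] unfolding q
      by (intro divide_neg_pos) linarith+
  qed (use pos less in auto)
  with q that show thesis by blast
qed

section \<open>Realizing every value from 1 to \<open>B div 2 + 2\<close>\<close>

theorem theorem5p1:
  fixes D s B :: nat and u :: "nat \<Rightarrow> nat"
  assumes "D \<ge> 2" and "squarefree D"
    and "s \<ge> 1" and "u s = u 0" and "\<forall>i\<ge>1. u (i + s) = u i"
    and "cf_coeff (omega D) 0 = \<lceil>real (u 0) / 2\<rceil>"
    and "\<forall>i\<ge>1. cf_coeff (omega D) i = int (u i)"
    and "B = Max {u i | i. i \<ge> 1 \<and> odd i}"
  shows "{1..nat \<lfloor>real B / 2\<rfloor> + 2} \<subseteq> num_partitions D ` totally_positive_integers D"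
proof
  fix m assume "m \<in> {1..nat \<lfloor>real B / 2\<rfloor> + 2}"
  moreover have "nat \<lfloor>real B / 2\<rfloor> = B div 2"
    by (metis floor_divide_of_nat_eq nat_int of_nat_numeral)
  ultimately have m: "m \<ge> 1" "m \<le> B div 2 + 2" by auto
  have "finite {u i | i. i \<ge> 1 \<and> odd i}"
    by (rule finite_subset[OF _ periodic_range_finite[OF assms(3,5)]]) auto
  moreover have "{u i | i. i \<ge> 1 \<and> odd i} \<noteq> {}"
    using odd_one by blast
  ultimately have "B \<in> {u i | i. i \<ge> 1 \<and> odd i}"
    unfolding assms(8) by (rule Max_in)
  then obtain i where i: "B = u i" "i \<ge> 1" "odd i" by blast
  then obtain n where n: "i = Suc n" "even n" by (cases i) auto
  let ?z = "complete_quotient (omega D) (Suc n)"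
  obtain E F E' F' where basis: "adapted_basis E F E' F' (totally_positive_integers D)"
    and F: "F = - E / ?z"
    using adapted_basis_convergents[OF assms(1,2) n(2)] .
  interpret adapted_basis E F E' F' "totally_positive_integers D" by (rule basis)
  have "?z \<notin> \<rat>" and z: "?z > 1"
    using omega_irrational[OF assms(1,2)] complete_quotient_irrational complete_quotient_Suc_gt_1
    by blast+
  \<comment> \<open>Irrationality makes \<open>B < ?z\<close> strict, as positivity of
    \<open>E + k F\<close> requires in the extreme case \<open>k = B\<close>.\<close>
  then have "?z \<noteq> of_int (int B)"
    by (metis Rats_of_int)
  moreover have "of_int (int B) \<le> ?z"
    using assms(7) i n by (metis cf_coeff_def of_int_floor_le)
  ultimately have zB: "real B < ?z" by simp
  show "m \<in> num_partitions D ` totally_positive_integers D"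
  proof (cases "m = 1")
    case True
    have "num_partitions D (pt 1 0) = 1"
      unfolding num_partitions_def partitions_def partitions_E by simp
    moreover have "pt 1 0 \<in> totally_positive_integers D"
      using E_pos by (intro pt_1_in_T) auto
    ultimately show ?thesis using True by (metis imageI)
  next
    case False
    \<comment> \<open>Solves \<open>k div 2 + 2 = m\<close>. Here \<open>m \<ge> 2\<close>, so the
      natural subtraction is exact, and \<open>m \<le> B div 2 + 2\<close> gives
      \<open>k \<le> B\<close>.\<close>
    define k where "k = 2 * (m - 2)"
    have km: "k \<le> B" "k div 2 + 2 = m" using m False by (auto simp: k_def)
    have "real k < ?z" using km zB by linarith
    then have "E + of_nat k * F > 0"
      using z E_pos unfolding F
      by (simp del: complete_quotient.simps add: field_simps)
    from card_partitions_2E_kF[OF this] show ?thesis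
      unfolding num_partitions_def partitions_def km by (intro image_eqI) simp_all
  qed
qed

end
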